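(* Let $m$ and $n$ be positive integers with $\gcd(m,n)=1$. Then $$\Phi_n(X^m)=\prod_{d\mid m}\Phi_{d\cdot n}(X),$$ where the product runs over all positive divisors $d$ of $m$.
   Context: For each positive integer $n$, $\Phi_n(X)$ denotes the $n$-th cyclotomic polynomial, i.e. the monic polynomial whose roots are the primitive $n$-th roots of unity: $\Phi_n(X)=\prod_{1\le k\le n,\ \gcd(k,n)=1}\left(X-e^{2\pi i k/n}\right)\in\mathbb{Z}[X]$. *)

theory Defs
  imports Complex_Main "HOL-Computational_Algebra.Polynomial"
begin

(* The coefficients are integers, but the defining product lives in C[X]; identities between
   cyclotomic polynomials are stated there, Z[X] being a subring of C[X].
   Meaningful for n > 0 only; the index 0 gives the empty product 1. *)
definition cyclotomic :: "nat \<Rightarrow> complex poly" where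
  "cyclotomic n =
     (\<Prod>k | 1 \<le> k \<and> k \<le> n \<and> coprime k n.
        [:- exp (2 * of_real pi * \<i> * of_nat k / of_nat n), 1:])"

end

theory Submission
  imports Defs "HOL-Analysis.Complex_Transcendental"
begin

text \<open>
  Let \<open>P n\<close> be the set of primitive \<open>n\<close>-th roots of unity. For \<open>w \<noteq> 0\<close> the polynomial
  \<open>X^m - w\<close> is the product of \<open>X - z\<close> over the \<open>m\<close> distinct \<open>m\<close>-th roots \<open>z\<close> of \<open>w\<close>, so both sides
  of the identity are products of \<open>X - z\<close> over sets of roots. It remains to see that \<open>z^m \<in> P n\<close>
  holds iff \<open>z \<in> P (d * n)\<close> for some \<open>d\<close> dividing \<open>m\<close>, and coprimality of \<open>m\<close> and \<open>n\<close> gives this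
  by comparing the orders of \<open>z\<close> and \<open>z^m\<close>.
\<close>

text \<open>Membership means having order exactly \<open>n\<close>; for \<open>n = 0\<close> this is
  infinite order. The form as an equivalence turns equations between powers into
  divisibilities.\<close>

definition primitive_roots :: "nat \<Rightarrow> 'a::monoid_mult set" where
  "primitive_roots n = {z. \<forall>k. z ^ k = 1 \<longleftrightarrow> n dvd k}"

lemma primitive_rootsD: "z \<in> primitive_roots n \<Longrightarrow> z ^ k = 1 \<longleftrightarrow> n dvd k"
  by (simp add: primitive_roots_def)

lemma primitive_roots_disjoint:
  assumes "a \<noteq> b"
  shows "primitive_roots a \<inter> primitive_roots b = ({} :: 'a::monoid_mult set)"
proof -
  have dvd: "b dvd a" if "z \<in> primitive_roots a" "z \<in> primitive_roots b" for a b and z :: 'a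
    using primitive_rootsD[OF that(1), of a] primitive_rootsD[OF that(2), of a] by simp
  show ?thesis
    using assms dvd_antisym[OF dvd dvd] by blast
qed

lemma root_of_unity_primitive:
  fixes z :: "'a::monoid_mult"
  assumes "n > 0" "z ^ n = 1"
  obtains d where "z \<in> primitive_roots d"
proof -
  define d where "d = (LEAST k. k > 0 \<and> z ^ k = 1)"
  have d: "d > 0" "z ^ d = 1"
    using LeastI[of "\<lambda>k. k > 0 \<and> z ^ k = 1" n] assms by (auto simp: d_def)
  have least: "d \<le> k" if "k > 0" "z ^ k = 1" for k
    unfolding d_def by (rule Least_le) (use that in simp)
  \<comment> \<open>Dividing \<open>k\<close> by \<open>d\<close> leaves a remainder below
    \<open>d\<close>; if its power of \<open>z\<close> is 1, minimality of \<open>d\<close> forces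
    it to be 0.\<close>
  have ord: "z ^ k = 1 \<longleftrightarrow> d dvd k" for k
  proof -
    have "z ^ k = z ^ (d * (k div d) + k mod d)"
      by simp
    also have "\<dots> = z ^ (k mod d)"
      unfolding power_add power_mult using d by simp
    finally have "z ^ k = z ^ (k mod d)" .
    then show ?thesis
      using least[of "k mod d"] d mod_less_divisor[of d k]
      by (metis dvd_eq_mod_eq_0 gr0I leD power_0)
  qed
  show thesis
    by (rule that[of d]) (simp add: primitive_roots_def ord)
qed

lemma power_mem_primitive_roots_iff:
  fixes z :: "'a::monoid_mult"
  assumes "m > 0" "n > 0" "coprime m n"
  shows "z ^ m \<in> primitive_roots n \<longleftrightarrow> (\<exists>d. d dvd m \<and> z \<in> primitive_roots (d * n))"
proof
  assume "z ^ m \<in> primitive_roots n"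
  then have zm: "z ^ (m * k) = 1 \<longleftrightarrow> n dvd k" for k
    by (simp add: power_mult primitive_rootsD)
  have "z ^ (m * n) = 1"
    using zm by simp
  then obtain N where N: "z \<in> primitive_roots N"
    using root_of_unity_primitive[of "m * n" z] assms by auto
  \<comment> \<open>Here \<open>z ^ (m * N) = (z ^ N) ^ m = 1\<close>.\<close>
  have "n dvd N"
    using zm[of N] primitive_rootsD[OF N] by simp
  then obtain d where d: "N = d * n"
    by (metis dvdE mult.commute)
  have "N dvd m * n"
    using zm[of n] primitive_rootsD[OF N] by simp
  then have "d dvd m"
    using assms d by simp
  then show "\<exists>d. d dvd m \<and> z \<in> primitive_roots (d * n)"
    using N d by blast
next
  assume "\<exists>d. d dvd m \<and> z \<in> primitive_roots (d * n)"
  then obtain d e where m: "m = d * e" and z: "z \<in> primitive_roots (d * n)"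
    by blast
  \<comment> \<open>The condition \<open>z ^ (m * k) = 1\<close> reads
    \<open>d * n dvd d * e * k\<close>. Cancelling \<open>d\<close> and then \<open>e\<close>, which
    is coprime to \<open>n\<close> as a divisor of \<open>m\<close>, leaves
    \<open>n dvd k\<close>.\<close>
  have "coprime n e" "d > 0"
    using assms m by (auto simp: coprime_commute)
  then show "z ^ m \<in> primitive_roots n"
    using primitive_rootsD[OF z] m
    by (auto simp: primitive_roots_def power_mult[symmetric] mult.assoc coprime_dvd_mult_right_iff)
qed

lemma finite_primitive_roots:
  assumes "n > 0"
  shows "finite (primitive_roots n :: complex set)"
proof (rule finite_subset)
  show "finite {z :: complex. z ^ n = 1}"
    using assms by (rule finite_nth_roots)
  show "primitive_roots n \<subseteq> {z :: complex. z ^ n = 1}"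
    by (intro subsetI CollectI) (simp add: primitive_rootsD)
qed

lemma bij_betw_primitive_roots:
  assumes "n > 0"
  shows "bij_betw (\<lambda>k. exp (2 * of_real pi * \<i> * of_nat k / of_nat n))
           {k. 1 \<le> k \<and> k \<le> n \<and> coprime k n} (primitive_roots n)"
    (is "bij_betw ?f ?K _")
  unfolding bij_betw_def
proof
  show "inj_on ?f ?K"
  proof (rule inj_onI)
    fix j k assume jk: "j \<in> ?K" "k \<in> ?K" and "?f j = ?f k"
    then have "j mod n = k mod n"
      using complex_root_unity_eq[of n j k] assms by simp
    \<comment> \<open>Between 1 and \<open>n\<close>, only \<open>n\<close> itself has residue
      0.\<close>
    then show "j = k"
      using jk by (cases "j = n"; cases "k = n") auto
  qed
  have pow: "?f j ^ k = 1 \<longleftrightarrow> n dvd j * k" for j k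
  proof -
    have "?f j ^ k = ?f (j * k)"
      by (simp add: exp_of_nat_mult[symmetric] mult_ac)
    then show ?thesis
      using complex_root_unity_eq_1[of n "j * k"] assms by simp
  qed
  show "?f ` ?K = primitive_roots n"
  proof
    show "?f ` ?K \<subseteq> primitive_roots n"
      by (auto simp: primitive_roots_def pow coprime_commute coprime_dvd_mult_right_iff)
  next
    show "primitive_roots n \<subseteq> ?f ` ?K"
    proof
      fix z :: complex assume z: "z \<in> primitive_roots n"
      then have "z ^ n = 1"
        by (simp add: primitive_rootsD)
      then obtain i where i: "i < n" "z = ?f i"
        using complex_roots_unity[of n] assms by auto
      \<comment> \<open>The roots are listed with indices from 0 to \<open>n - 1\<close>, but
        \<open>?K\<close> lies in 1 to \<open>n\<close>, so 0 is traded for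
        \<open>n\<close>.\<close>
      define j where "j = (if i = 0 then n else i)"
      have "?f i = ?f j"
        using complex_root_unity_eq[of n i j] assms by (simp add: j_def)
      then have zj: "z = ?f j"
        using i by simp
      have "coprime j n"
      proof -
        \<comment> \<open>The exponent \<open>n div gcd j n\<close> sends \<open>z\<close> to 1, so
          order \<open>n\<close> leaves no room for a gcd above 1.\<close>
        have "j * (n div gcd j n) = n * (j div gcd j n)"
          by (simp add: div_mult_swap mult.commute)
        then have "n dvd j * (n div gcd j n)"
          by simp
        then have "n dvd n div gcd j n"
          using primitive_rootsD[OF z, of "n div gcd j n"] pow zj by simp
        then have "n \<le> n div gcd j n"
          using assms by (intro dvd_imp_le) (auto simp: div_greater_zero_iff gcd_le2_nat)
        then have "\<not> 1 < gcd j n"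
          using assms div_less_dividend[of "gcd j n" n] by linarith
        moreover have "gcd j n > 0"
          using assms by simp
        ultimately have "gcd j n = 1"
          by linarith
        then show ?thesis
          by (simp add: coprime_iff_gcd_eq_1)
      qed
      then show "z \<in> ?f ` ?K"
        using zj i assms by (intro image_eqI[of _ _ j]) (auto simp: j_def)
    qed
  qed
qed

lemma cyclotomic_altdef:
  assumes "n > 0"
  shows "cyclotomic n = (\<Prod>z\<in>primitive_roots n. [:- z, 1:])"
  unfolding cyclotomic_def
  by (rule prod.reindex_bij_betw[OF bij_betw_primitive_roots[OF assms]])

text \<open>Both sides have degree at most \<open>m\<close> and leading coefficient 1 at
  \<open>m\<close>, so their difference has degree below \<open>m\<close>. It vanishes at the
  \<open>m\<close> roots, which are distinct because \<open>w \<noteq> 0\<close>.\<close>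

lemma monom_minus_const_factorization:
  fixes w :: complex
  assumes "m > 0" "w \<noteq> 0"
  shows "monom 1 m - [:w:] = (\<Prod>z | z ^ m = w. [:- z, 1:])"
proof (rule poly_eqI_degree_lead_coeff)
  let ?A = "{z. z ^ m = w}"
  have fin: "finite ?A" and card: "card ?A = m"
    using assms by (auto intro: finite_nth_roots card_nth_roots)
  have deg: "degree (\<Prod>z\<in>?A. [:- z, 1:]) = m"
    by (subst degree_prod_eq_sum_degree) (auto simp: card)
  then show "degree (\<Prod>z\<in>?A. [:- z, 1:]) \<le> m"
    by simp
  show "degree (monom 1 m - [:w:]) \<le> m"
    by (intro degree_diff_le) (auto simp: degree_monom_le)
  have "coeff (\<Prod>z\<in>?A. [:- z, 1:]) m = 1"
    using lead_coeff_prod[of "\<lambda>z. [:- z, 1:]" ?A] deg by simp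
  then show "coeff (monom 1 m - [:w:]) m = coeff (\<Prod>z\<in>?A. [:- z, 1:]) m"
    using assms by (simp add: coeff_pCons split: nat.split)
  show "m \<le> card ?A"
    by (simp add: card)
  show "poly (monom 1 m - [:w:]) z = poly (\<Prod>z\<in>?A. [:- z, 1:]) z" if "z \<in> ?A" for z
  proof -
    have "(\<Prod>x\<in>?A. poly [:- x, 1:] z) = 0"
      using that fin by (intro prod_zero) auto
    then show ?thesis
      using that by (simp add: poly_monom poly_prod)
  qed
qed

theorem theorem1p1:
  fixes m n :: nat
  assumes "m > 0" and "n > 0" and "coprime m n"
  shows "pcompose (cyclotomic n) (monom 1 m) = (\<Prod>d | d dvd m. cyclotomic (d * n))"
proof -
  let ?P = "primitive_roots :: nat \<Rightarrow> complex set"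
  let ?R = "\<lambda>w :: complex. {z. z ^ m = w}"
  have nz: "w \<noteq> 0" if "w \<in> ?P n" for w
    using primitive_rootsD[OF that, of n] assms by (auto simp: power_0_left)
  have pos: "d * n > 0" if "d dvd m" for d
    using that assms dvd_pos_nat[of m d] by simp
  have "pcompose (cyclotomic n) (monom 1 m) = (\<Prod>w\<in>?P n. pcompose [:- w, 1:] (monom 1 m))"
    using assms by (simp add: cyclotomic_altdef pcompose_prod)
  also have "\<dots> = (\<Prod>w\<in>?P n. \<Prod>z\<in>?R w. [:- z, 1:])"
  proof (rule prod.cong[OF refl])
    fix w assume "w \<in> ?P n"
    have "pcompose [:- w, 1:] (monom 1 m) = monom 1 m - [:w:]"
      by (simp add: pcompose_pCons)
    then show "pcompose [:- w, 1:] (monom 1 m) = (\<Prod>z\<in>?R w. [:- z, 1:])"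
      using monom_minus_const_factorization[OF assms(1) nz[OF \<open>w \<in> ?P n\<close>]] by simp
  qed
  \<comment> \<open>Fibres of \<open>z \<mapsto> z ^ m\<close> over different \<open>w\<close> are
    disjoint, so no factor is merged.\<close>
  also have "\<dots> = (\<Prod>z\<in>(\<Union>w\<in>?P n. ?R w). [:- z, 1:])"
    using assms
    by (intro prod.UNION_disjoint[symmetric]) (auto simp: finite_primitive_roots finite_nth_roots)
  also have "(\<Union>w\<in>?P n. ?R w) = (\<Union>d\<in>{d. d dvd m}. ?P (d * n))"
    using power_mem_primitive_roots_iff[OF assms] by auto
  \<comment> \<open>Distinct \<open>d\<close> give distinct orders \<open>d * n\<close> since
    \<open>n > 0\<close>, so this union is disjoint too.\<close>
  also have "(\<Prod>z\<in>\<dots>. [:- z, 1:]) = (\<Prod>d | d dvd m. \<Prod>z\<in>?P (d * n). [:- z, 1:])"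
    using assms pos
    by (intro prod.UNION_disjoint ballI impI primitive_roots_disjoint)
       (auto simp: finite_primitive_roots)
  also have "\<dots> = (\<Prod>d | d dvd m. cyclotomic (d * n))"
    using pos by (intro prod.cong refl cyclotomic_altdef[symmetric]) simp
  finally show ?thesis .
qed

end
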